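(* Let $\Lambda$ be a finite nonempty set, $X$ a finite nonempty set, and let $\mathbf{Q}_1=\{q_t^z : t\in\Lambda,\ z\in X^{\Lambda\setminus\{t\}}\}$ be a family in which each $q_t^z$ is a probability distribution on $X^t$ with $q_t^z(x)>0$ for all $x\in X^t$. Then there exists a unique random field $P_\Lambda$ on $X^\Lambda$ compatible with $\mathbf{Q}_1$ if and only if for all distinct $t,s\in\Lambda$ and all $x,u\in X^t$, $y,v\in X^s$, $z\in X^{\Lambda\setminus\{t,s\}}$, $$q_t^{zy}(x)\,q_s^{zx}(v)\,q_t^{zv}(u)\,q_s^{zu}(y)=q_t^{zy}(u)\,q_s^{zu}(v)\,q_t^{zv}(x)\,q_s^{zx}(y).$$
   Context: Each point $t\in\Lambda$ is associated with a copy $X^t$ of $X$. For $V\subseteq\Lambda$, $X^V=\{(x_t)_{t\in V}: x_t\in X^t\}$ is the set of configurations on $V$ (with $X^\emptyset$ consisting of the empty configuration only), and $X^{\{t\}}$ is identified with $X^t$. For disjoint $V,I\subset\Lambda$ and $x\in X^V$, $y\in X^I$, $xy\in X^{V\cup I}$ denotes the concatenation: the configuration equal to $x$ on $V$ and to $y$ on $I$ (the order of writing is irrelevant). A random field $P_\Lambda$ is a probability distribution on $X^\Lambda$. Its one-point conditional distribution is the family $\mathbf{Q}_1(P_\Lambda)=\{Q_t^z : t\in\Lambda,\ z\in X^{\Lambda\setminus\{t\}}\}$, where $$Q_t^z(x)=\frac{P_\Lambda(xz)}{\sum_{u\in X^t}P_\Lambda(uz)},\qquad x\in X^t .$$ $P_\Lambda$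 is compatible with $\mathbf{Q}_1$ if $\mathbf{Q}_1(P_\Lambda)=\mathbf{Q}_1$, i.e. for all $t\in\Lambda$ and $z\in X^{\Lambda\setminus\{t\}}$ the conditional probabilities $Q_t^z(x)=P_\Lambda(xz)/\sum_{u\in X^t}P_\Lambda(uz)$, $x\in X^t$, are defined (the denominator $\sum_{u\in X^t}P_\Lambda(uz)$ is positive) and $Q_t^z=q_t^z$. *)

theory Defs
  imports "HOL-Probability.Probability_Mass_Function"
begin

text \<open>
  The space of configurations on \<open>V\<close> is the set of extensional functions \<open>V \<rightarrow>\<^sub>E X\<close>; for
  \<open>V = {}\<close> it contains exactly one element, the empty configuration. As a configuration on
  \<open>{t}\<close> is identified with its value in \<open>X\<close>, the concatenation of \<open>x \<in> X\<close> at the point \<open>t\<close> with a configuration \<open>z\<close> on a set \<open>V\<close> not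
  containing \<open>t\<close> is the function update \<open>z(t := x)\<close>, which lies in \<open>insert t V \<rightarrow>\<^sub>E X\<close>.
\<close>

abbreviation configs :: "'x set \<Rightarrow> 'i set \<Rightarrow> ('i \<Rightarrow> 'x) set" where
  "configs X V \<equiv> V \<rightarrow>\<^sub>E X"

text \<open>
  A probability distribution on a finite set \<open>A\<close> is a \<open>pmf\<close> on the ambient type whose support is
  contained in \<open>A\<close>.
\<close>

definition random_field :: "'i set \<Rightarrow> 'x set \<Rightarrow> ('i \<Rightarrow> 'x) pmf \<Rightarrow> bool" where
  "random_field \<Lambda> X P \<longleftrightarrow> set_pmf P \<subseteq> configs X \<Lambda>"

definition one_point_marginal :: "'x set \<Rightarrow> ('i \<Rightarrow> 'x) pmf \<Rightarrow> 'i \<Rightarrow> ('i \<Rightarrow> 'x) \<Rightarrow> real" where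
  "one_point_marginal X P t z = (\<Sum>u\<in>X. pmf P (z(t := u)))"

definition one_point_conditional ::
    "'x set \<Rightarrow> ('i \<Rightarrow> 'x) pmf \<Rightarrow> 'i \<Rightarrow> ('i \<Rightarrow> 'x) \<Rightarrow> 'x \<Rightarrow> real" where
  "one_point_conditional X P t z x = pmf P (z(t := x)) / one_point_marginal X P t z"

text \<open>
  Families \<open>q t z\<close> are total functions; only the values at \<open>t \<in> \<Lambda>\<close> and \<open>z \<in> configs X (\<Lambda> - {t})\<close>
  are constrained or used.
\<close>

definition positive_one_point_family ::
    "'i set \<Rightarrow> 'x set \<Rightarrow> ('i \<Rightarrow> ('i \<Rightarrow> 'x) \<Rightarrow> 'x pmf) \<Rightarrow> bool" where
  "positive_one_point_family \<Lambda> X q \<longleftrightarrow>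
     (\<forall>t\<in>\<Lambda>. \<forall>z\<in>configs X (\<Lambda> - {t}). set_pmf (q t z) \<subseteq> X \<and> (\<forall>x\<in>X. pmf (q t z) x > 0))"

text \<open>
  Since \<open>a / 0 = 0\<close> in HOL, the conditional probabilities being defined has to be required
  separately.
\<close>

definition compatible_with ::
    "'i set \<Rightarrow> 'x set \<Rightarrow> ('i \<Rightarrow> 'x) pmf \<Rightarrow> ('i \<Rightarrow> ('i \<Rightarrow> 'x) \<Rightarrow> 'x pmf) \<Rightarrow> bool" where
  "compatible_with \<Lambda> X P q \<longleftrightarrow>
     (\<forall>t\<in>\<Lambda>. \<forall>z\<in>configs X (\<Lambda> - {t}).
        one_point_marginal X P t z > 0 \<and>
        (\<forall>x\<in>X. one_point_conditional X P t z x = pmf (q t z) x))"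

end

theory Submission
  imports Defs
begin

text \<open>
  Write \<open>g t w\<close> for the conditional probability of the spin of \<open>w\<close> at \<open>t\<close> given the rest of \<open>w\<close>.
  A positive field is compatible with the family iff its weights satisfy the balance equations
  \<open>W w * g t (w') = W w' * g t w\<close> whenever \<open>w'\<close> differs from \<open>w\<close> only at \<open>t\<close>. Multiplying these
  equations around a square of spin flips at \<open>t\<close> and \<open>s\<close> gives the cycle condition. Conversely, a
  weight balanced at all sites of \<open>V\<close> is made balanced at a further site \<open>t\<close> by freezing the spin at
  \<open>t\<close> to a reference value \<open>c\<close> and multiplying by \<open>g t w / g t (w(t := c))\<close>; the cycle condition
  says exactly that balance at the sites of \<open>V\<close> is preserved. Finally, the quotient of two balanced
  weights is invariant under single-site changes, hence constant, which gives uniqueness.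
\<close>

section \<open>Balance and cycles on full configurations\<close>

text \<open>Since configurations are extensional, writing \<open>undefined\<close> at
  \<open>t\<close> restricts \<open>w\<close> to \<open>\<Lambda> - {t}\<close>. All conditions can
  then be stated on full configurations, without index sets that change with the site.\<close>

definition spin_prob :: "('i \<Rightarrow> ('i \<Rightarrow> 'x) \<Rightarrow> 'x pmf) \<Rightarrow> 'i \<Rightarrow> ('i \<Rightarrow> 'x) \<Rightarrow> real" where
  "spin_prob q t w = pmf (q t (w(t := undefined))) (w t)"

text \<open>Detailed balance for the single-site heat-bath dynamics, in product form so that it
  makes sense for unnormalised weights.\<close>

definition balanced_at ::
    "'i set \<Rightarrow> 'x set \<Rightarrow> ('i \<Rightarrow> ('i \<Rightarrow> 'x) \<Rightarrow> real) \<Rightarrow> (('i \<Rightarrow> 'x) \<Rightarrow> real) \<Rightarrow> 'i \<Rightarrow> bool" where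
  "balanced_at \<Lambda> X g W t \<longleftrightarrow>
     (\<forall>w\<in>configs X \<Lambda>. \<forall>b\<in>X. W w * g t (w(t := b)) = W (w(t := b)) * g t w)"

text \<open>Kolmogorov's cycle criterion for the heat-bath dynamics on the square of flips at
  \<open>t\<close> and \<open>s\<close>: each side is the product of the transition rates around the
  square in one direction.\<close>

definition cycle_condition ::
    "'i set \<Rightarrow> 'x set \<Rightarrow> ('i \<Rightarrow> ('i \<Rightarrow> 'x) \<Rightarrow> real) \<Rightarrow> bool" where
  "cycle_condition \<Lambda> X g \<longleftrightarrow>
     (\<forall>t\<in>\<Lambda>. \<forall>s\<in>\<Lambda>. t \<noteq> s \<longrightarrow> (\<forall>w\<in>configs X \<Lambda>. \<forall>u\<in>X. \<forall>v\<in>X.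
        g t w * g s (w(s := v)) * g t (w(t := u, s := v)) * g s (w(t := u)) =
        g t (w(t := u)) * g s (w(t := u, s := v)) * g t (w(s := v)) * g s w))"

lemma configs_upd:
  assumes "w \<in> configs X \<Lambda>" "t \<in> \<Lambda>" "b \<in> X"
  shows "w(t := b) \<in> configs X \<Lambda>"
  using assms by (auto simp: PiE_iff extensional_def)

lemma configs_insert_upd:
  assumes "z \<in> configs X (\<Lambda> - {t})" "t \<in> \<Lambda>" "b \<in> X"
  shows "z(t := b) \<in> configs X \<Lambda>"
  using assms by (auto simp: PiE_iff extensional_def)

lemma configs_remove:
  assumes "w \<in> configs X \<Lambda>"
  shows "w(t := undefined) \<in> configs X (\<Lambda> - {t})"
  using assms by (auto simp: PiE_iff extensional_def)

lemma spin_prob_upd: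
  assumes "z \<in> configs X (\<Lambda> - {t})"
  shows "spin_prob q t (z(t := a)) = pmf (q t z) a"
proof -
  have "z(t := undefined) = z"
    using assms by (auto simp: PiE_iff extensional_def)
  then show ?thesis by (simp add: spin_prob_def)
qed

lemma spin_prob_pos:
  assumes "positive_one_point_family \<Lambda> X q" "t \<in> \<Lambda>" "w \<in> configs X \<Lambda>"
  shows "spin_prob q t w > 0"
  using assms configs_remove[OF assms(3), of t] PiE_mem[OF assms(3,2)]
  by (auto simp: positive_one_point_family_def spin_prob_def)

text \<open>A triple \<open>x\<close>, \<open>y\<close>, \<open>z\<close> is the same datum as
  \<open>w = z(t := x, s := y)\<close>, so the two conditions are reparametrisations of each
  other.\<close>

lemma cycle_condition_spin_prob_iff:
  "cycle_condition \<Lambda> X (spin_prob q) \<longleftrightarrow>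
    (\<forall>t\<in>\<Lambda>. \<forall>s\<in>\<Lambda>. t \<noteq> s \<longrightarrow>
      (\<forall>x\<in>X. \<forall>u\<in>X. \<forall>y\<in>X. \<forall>v\<in>X. \<forall>z\<in>configs X (\<Lambda> - {t, s}).
        pmf (q t (z(s := y))) x * pmf (q s (z(t := x))) v *
        pmf (q t (z(s := v))) u * pmf (q s (z(t := u))) y =
        pmf (q t (z(s := y))) u * pmf (q s (z(t := u))) v *
        pmf (q t (z(s := v))) x * pmf (q s (z(t := x))) y))"
  (is "?L \<longleftrightarrow> ?R")
proof -
  let ?g = "spin_prob q"
  have at_t: "?g t (z(t := a, s := b)) = pmf (q t (z(s := b))) a"
    and at_s: "?g s (z(t := a, s := b)) = pmf (q s (z(t := a))) b"
    if "t \<noteq> s" "z \<in> configs X (\<Lambda> - {t, s})" for t s z a b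
  proof -
    \<comment> \<open>\<open>z\<close> is already \<open>undefined\<close> at both sites, so erasing
      one spin leaves only the other update.\<close>
    have "z(t := a, s := b, t := undefined) = z(s := b)"
      "z(t := a, s := b, s := undefined) = z(t := a)"
      using that by (auto simp: fun_eq_iff PiE_iff extensional_def)
    then show "?g t (z(t := a, s := b)) = pmf (q t (z(s := b))) a"
      "?g s (z(t := a, s := b)) = pmf (q s (z(t := a))) b"
      using \<open>t \<noteq> s\<close> by (simp_all add: spin_prob_def)
  qed
  show ?thesis
  proof
    assume L: ?L
    show ?R
    proof (intro ballI impI)
      fix t s x u y v z
      assume *: "t \<in> \<Lambda>" "s \<in> \<Lambda>" "t \<noteq> s" "x \<in> X" "u \<in> X" "y \<in> X" "v \<in> X"
        "z \<in> configs X (\<Lambda> - {t, s})"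
      define w where "w = z(t := x, s := y)"
      have w: "w \<in> configs X \<Lambda>"
        using * by (auto simp: w_def PiE_iff extensional_def)
      have upds: "w(s := v) = z(t := x, s := v)" "w(t := u) = z(t := u, s := y)"
        using * by (auto simp: w_def fun_eq_iff)
      show "pmf (q t (z(s := y))) x * pmf (q s (z(t := x))) v *
        pmf (q t (z(s := v))) u * pmf (q s (z(t := u))) y =
        pmf (q t (z(s := y))) u * pmf (q s (z(t := u))) v *
        pmf (q t (z(s := v))) x * pmf (q s (z(t := x))) y"
        using L[unfolded cycle_condition_def, rule_format, OF *(1-3) w *(5) *(7)]
        unfolding upds fun_upd_upd unfolding w_def at_t[OF *(3) *(8)] at_s[OF *(3) *(8)] .
    qed
  next
    assume R: ?R
    show ?L
      unfolding cycle_condition_def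
    proof (intro ballI impI)
      fix t s w u v
      assume *: "t \<in> \<Lambda>" "s \<in> \<Lambda>" "t \<noteq> s" "w \<in> configs X \<Lambda>" "u \<in> X" "v \<in> X"
      define z where "z = w(t := undefined, s := undefined)"
      have z: "z \<in> configs X (\<Lambda> - {t, s})" and wX: "w t \<in> X" "w s \<in> X"
        using * by (auto simp: z_def PiE_iff extensional_def)
      have upds: "w(s := v) = z(t := w t, s := v)" "w(t := u) = z(t := u, s := w s)"
        using * by (auto simp: z_def fun_eq_iff)
      have w: "w = z(t := w t, s := w s)"
        using * by (auto simp: z_def fun_eq_iff)
      have "?g t w = pmf (q t (z(s := w s))) (w t)" "?g s w = pmf (q s (z(t := w t))) (w s)"
        using at_t[OF *(3) z, of "w t" "w s"] at_s[OF *(3) z, of "w t" "w s"] w by simp_all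
      then show "?g t w * ?g s (w(s := v)) * ?g t (w(t := u, s := v)) * ?g s (w(t := u)) =
        ?g t (w(t := u)) * ?g s (w(t := u, s := v)) * ?g t (w(s := v)) * ?g s w"
        using R[rule_format, OF *(1-3) wX(1) *(5) wX(2) *(6) z]
        unfolding upds fun_upd_upd by (simp only: at_t[OF *(3) z] at_s[OF *(3) z])
    qed
  qed
qed

section \<open>Building a balanced weight site by site\<close>

lemma balanced_at_extend:
  assumes pos: "\<And>t w. t \<in> \<Lambda> \<Longrightarrow> w \<in> configs X \<Lambda> \<Longrightarrow> g t w > (0::real)"
    and cyc: "cycle_condition \<Lambda> X g"
    and "t \<in> \<Lambda>" "s \<in> \<Lambda>" "t \<noteq> s" "c \<in> X"
    and bal: "balanced_at \<Lambda> X g W s"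
  shows "balanced_at \<Lambda> X g (\<lambda>w. W (w(t := c)) * g t w / g t (w(t := c))) s"
  unfolding balanced_at_def
proof (intro ballI)
  fix w b assume w: "w \<in> configs X \<Lambda>" and b: "b \<in> X"
  have twist: "w(s := b, t := c) = w(t := c, s := b)"
    using \<open>t \<noteq> s\<close> by (simp add: fun_upd_twist)
  have wc: "w(t := c) \<in> configs X \<Lambda>" and wcb: "w(t := c, s := b) \<in> configs X \<Lambda>"
    using w b assms by (auto intro!: configs_upd)
  have p: "g t (w(t := c)) > 0" "g t (w(t := c, s := b)) > 0" "g s (w(t := c)) > 0"
    using wc wcb assms by (auto intro!: pos)
  let ?A = "W (w(t := c))" and ?B = "W (w(t := c, s := b))"
  have IH: "?A * g s (w(t := c, s := b)) = ?B * g s (w(t := c))"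
    using bal wc b by (auto simp: balanced_at_def)
  have cy: "g t w * g s (w(s := b)) * g t (w(t := c, s := b)) * g s (w(t := c)) =
        g t (w(t := c)) * g s (w(t := c, s := b)) * g t (w(s := b)) * g s w"
    using cyc assms w b by (auto simp: cycle_condition_def)
  have "(?A * g t w * g s (w(s := b)) * g t (w(t := c, s := b))) * g s (w(t := c)) =
        ?A * (g t (w(t := c)) * g s (w(t := c, s := b)) * g t (w(s := b)) * g s w)"
    unfolding cy[symmetric] by (simp only: mult_ac)
  also have "\<dots> = (?A * g s (w(t := c, s := b))) * (g t (w(t := c)) * g t (w(s := b)) * g s w)"
    by (simp only: mult_ac)
  also have "\<dots> = (?B * g t (w(s := b)) * g s w * g t (w(t := c))) * g s (w(t := c))"
    unfolding IH by (simp only: mult_ac)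
  finally have "?A * g t w * g s (w(s := b)) * g t (w(t := c, s := b)) =
      ?B * g t (w(s := b)) * g s w * g t (w(t := c))"
    using p(3) by simp
  then show "W (w(t := c)) * g t w / g t (w(t := c)) * g s (w(s := b)) =
     W (w(s := b, t := c)) * g t (w(s := b)) / g t (w(s := b, t := c)) * g s w"
    unfolding twist using p by (simp add: field_simps)
qed

text \<open>The induction is on the set \<open>V\<close> of balanced sites, while configurations
  always live on all of \<open>\<Lambda>\<close>.\<close>

lemma balanced_weight_exists:
  assumes pos: "\<And>t w. t \<in> \<Lambda> \<Longrightarrow> w \<in> configs X \<Lambda> \<Longrightarrow> g t w > (0::real)"
    and cyc: "cycle_condition \<Lambda> X g"
    and "finite V" "V \<subseteq> \<Lambda>" "X \<noteq> {}"
  shows "\<exists>W. (\<forall>w\<in>configs X \<Lambda>. W w > 0) \<and> (\<forall>t\<in>V. balanced_at \<Lambda> X g W t)"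
  using assms(3,4)
proof (induction V rule: finite_induct)
  case empty
  show ?case by (rule exI[of _ "\<lambda>_. 1"]) simp
next
  case (insert t V)
  then obtain W where W: "\<forall>w\<in>configs X \<Lambda>. W w > 0" "\<forall>t\<in>V. balanced_at \<Lambda> X g W t"
    by auto
  obtain c where c: "c \<in> X" using \<open>X \<noteq> {}\<close> by auto
  define W' where "W' = (\<lambda>w. W (w(t := c)) * g t w / g t (w(t := c)))"
  have t: "t \<in> \<Lambda>" using insert by simp
  have "\<forall>w\<in>configs X \<Lambda>. W' w > 0"
    unfolding W'_def
    using W(1) t c configs_upd[where t = t and b = c] by (metis divide_pos_pos mult_pos_pos pos)
  \<comment> \<open>Freezing makes \<open>W (w(t := c))\<close> and the denominator blind to the
    spin at \<open>t\<close>, so along flips at \<open>t\<close> the new weight is proportional to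
    \<open>g t\<close>.\<close>
  moreover have "balanced_at \<Lambda> X g W' t"
    by (simp add: balanced_at_def W'_def)
  moreover have "balanced_at \<Lambda> X g W' s" if "s \<in> V" for s
    unfolding W'_def using that insert W c by (intro balanced_at_extend pos cyc) auto
  ultimately show ?case by blast
qed

section \<open>Necessity of the cycle condition\<close>

lemma balanced_imp_cycle_condition:
  assumes pos: "\<And>w. w \<in> configs X \<Lambda> \<Longrightarrow> W w > 0"
    and bal: "\<And>t. t \<in> \<Lambda> \<Longrightarrow> balanced_at \<Lambda> X g W t"
  shows "cycle_condition \<Lambda> X g"
  unfolding cycle_condition_def
proof (intro ballI impI)
  fix t s w u v
  assume *: "t \<in> \<Lambda>" "s \<in> \<Lambda>" "t \<noteq> s" "w \<in> configs X \<Lambda>" "u \<in> X" "v \<in> X"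
  let ?wt = "w(t := u)" and ?ws = "w(s := v)" and ?wts = "w(t := u, s := v)"
  have C: "?wt \<in> configs X \<Lambda>" "?ws \<in> configs X \<Lambda>" "?wts \<in> configs X \<Lambda>"
    using * by (auto intro!: configs_upd)
  have ts: "?ws(t := u) = ?wts" using * by (simp add: fun_upd_twist)
  \<comment> \<open>Each edge of the square gives one equation, oriented so that either side of the
    product contains every corner weight exactly once; these positive weights then cancel.\<close>
  have 1: "W ?wt * g t w = W w * g t ?wt"
    and 2: "W w * g s ?ws = W ?ws * g s w"
    and 3: "W ?ws * g t ?wts = W ?wts * g t ?ws"
    and 4: "W ?wts * g s ?wt = W ?wt * g s ?wts"
    using bal[OF *(1)] bal[OF *(2)] * C ts unfolding balanced_at_def by metis+
  have "(W ?wt * W w * W ?ws * W ?wts) * (g t w * g s ?ws * g t ?wts * g s ?wt) =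
    (W ?wt * g t w) * (W w * g s ?ws) * (W ?ws * g t ?wts) * (W ?wts * g s ?wt)"
    by (simp only: mult_ac)
  also have "\<dots> = (W ?wt * W w * W ?ws * W ?wts) * (g t ?wt * g s ?wts * g t ?ws * g s w)"
    unfolding 1 2 3 4 by (simp only: mult_ac)
  finally show "g t w * g s ?ws * g t ?wts * g s ?wt = g t ?wt * g s ?wts * g t ?ws * g s w"
    using pos[OF *(4)] pos[OF C(1)] pos[OF C(2)] pos[OF C(3)] by simp
qed

text \<open>Single-site changes join any two configurations: \<open>override_on w w' V\<close> runs
  from \<open>w\<close> at \<open>V = {}\<close> to \<open>w'\<close> at
  \<open>V = \<Lambda>\<close>.\<close>

lemma single_site_invariant_imp_constant:
  assumes "finite \<Lambda>"
    and inv: "\<And>w t b. w \<in> configs X \<Lambda> \<Longrightarrow> t \<in> \<Lambda> \<Longrightarrow> b \<in> X \<Longrightarrow> f (w(t := b)) = f w"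
    and w: "w \<in> configs X \<Lambda>" and w': "w' \<in> configs X \<Lambda>"
  shows "f w = f w'"
proof -
  have "override_on w w' V \<in> configs X \<Lambda> \<and> f (override_on w w' V) = f w"
    if "finite V" "V \<subseteq> \<Lambda>" for V
    using that
  proof (induction V rule: finite_induct)
    case empty
    show ?case using w by simp
  next
    case (insert t V)
    have "override_on w w' (insert t V) = (override_on w w' V)(t := w' t)"
      by (rule override_on_insert)
    then show ?case
      using insert configs_upd inv PiE_mem[OF w'] by (metis insert_subset)
  qed
  moreover have "override_on w w' \<Lambda> = w'"
    using w w' by (auto simp: override_on_def fun_eq_iff PiE_iff extensional_def)
  ultimately show ?thesis
    using \<open>finite \<Lambda>\<close> by (metis subset_refl)
qed

section \<open>Compatibility as positivity plus balance\<close>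

text \<open>Both sides say that, with the spins off \<open>t\<close> fixed, \<open>P\<close> is
  proportional to the prescribed conditional; the positive constant is the marginal.\<close>

lemma balanced_iff_compatible:
  assumes "finite X" "X \<noteq> {}" and fam: "positive_one_point_family \<Lambda> X q"
    and "\<Lambda> \<noteq> {}"
  shows "compatible_with \<Lambda> X P q \<longleftrightarrow>
    (\<forall>w\<in>configs X \<Lambda>. pmf P w > 0) \<and> (\<forall>t\<in>\<Lambda>. balanced_at \<Lambda> X (spin_prob q) (pmf P) t)"
    (is "_ \<longleftrightarrow> ?R")
proof
  assume comp: "compatible_with \<Lambda> X P q"
  have eq: "pmf P w = spin_prob q t w * one_point_marginal X P t (w(t := undefined))"
    and mpos: "one_point_marginal X P t (w(t := undefined)) > 0"
    if "t \<in> \<Lambda>" "w \<in> configs X \<Lambda>" for t w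
  proof -
    let ?z = "w(t := undefined)"
    have z: "?z \<in> configs X (\<Lambda> - {t})" using that(2) by (rule configs_remove)
    have "w t \<in> X" using that by (auto simp: PiE_iff)
    then show m: "one_point_marginal X P t ?z > 0"
      and "pmf P w = spin_prob q t w * one_point_marginal X P t ?z"
      using comp that z
      by (force simp: compatible_with_def one_point_conditional_def spin_prob_def field_simps)+
  qed
  show ?R
  proof (intro conjI ballI)
    fix w assume w: "w \<in> configs X \<Lambda>"
    obtain t where t: "t \<in> \<Lambda>" using \<open>\<Lambda> \<noteq> {}\<close> by auto
    show "pmf P w > 0"
      unfolding eq[OF t w] using mpos[OF t w] spin_prob_pos[OF fam t w] by simp
  next
    fix t assume t: "t \<in> \<Lambda>"
    show "balanced_at \<Lambda> X (spin_prob q) (pmf P) t"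
      unfolding balanced_at_def
    proof (intro ballI)
      fix w b assume w: "w \<in> configs X \<Lambda>" and b: "b \<in> X"
      \<comment> \<open>The same marginal occurs for \<open>w\<close> and \<open>w(t := b)\<close>,
        as they agree off \<open>t\<close>.\<close>
      show "pmf P w * spin_prob q t (w(t := b)) = pmf P (w(t := b)) * spin_prob q t w"
        using eq[OF t w] eq[OF t configs_upd[OF w t b]] by simp
    qed
  qed
next
  assume R: ?R
  show "compatible_with \<Lambda> X P q"
    unfolding compatible_with_def
  proof (intro ballI conjI)
    fix t z assume t: "t \<in> \<Lambda>" and z: "z \<in> configs X (\<Lambda> - {t})"
    have C: "z(t := x) \<in> configs X \<Lambda>" if "x \<in> X" for x
      using configs_insert_upd[OF z t that] .
    show m: "one_point_marginal X P t z > 0"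
      unfolding one_point_marginal_def using R C assms by (intro sum_pos) auto
    fix x assume x: "x \<in> X"
    have "pmf P (z(t := x)) * pmf (q t z) u = pmf P (z(t := u)) * pmf (q t z) x" if "u \<in> X" for u
    proof -
      have "balanced_at \<Lambda> X (spin_prob q) (pmf P) t" using R t by blast
      then have "pmf P (z(t := x)) * spin_prob q t (z(t := x, t := u)) =
          pmf P (z(t := x, t := u)) * spin_prob q t (z(t := x))"
        using C[OF x] that unfolding balanced_at_def by blast
      then show ?thesis using spin_prob_upd[OF z] by simp
    qed
    \<comment> \<open>Summing over \<open>u\<close> eliminates it: \<open>q t z\<close> has mass 1
      and the weights of \<open>P\<close> add up to the marginal.\<close>
    then have "(\<Sum>u\<in>X. pmf P (z(t := x)) * pmf (q t z) u) =
        (\<Sum>u\<in>X. pmf P (z(t := u)) * pmf (q t z) x)"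
      by (intro sum.cong) auto
    moreover have "(\<Sum>u\<in>X. pmf (q t z) u) = 1"
      using fam t z assms by (intro sum_pmf_eq_1) (auto simp: positive_one_point_family_def)
    ultimately have "pmf P (z(t := x)) = one_point_marginal X P t z * pmf (q t z) x"
      by (simp add: one_point_marginal_def sum_distrib_left[symmetric] sum_distrib_right[symmetric])
    then show "one_point_conditional X P t z x = pmf (q t z) x"
      using m by (simp add: one_point_conditional_def)
  qed
qed

section \<open>Normalisation and uniqueness\<close>

lemma pmf_of_weight:
  assumes "finite A" "A \<noteq> {}" and pos: "\<And>a. a \<in> A \<Longrightarrow> W a > (0::real)"
  obtains P where "set_pmf P \<subseteq> A" "\<And>a. a \<in> A \<Longrightarrow> pmf P a = W a / sum W A"
proof -
  define f where "f a = (if a \<in> A then W a / sum W A else 0)" for a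
  have S: "sum W A > 0" using assms by (intro sum_pos) auto
  have nn: "f a \<ge> 0" for a
    using S pos by (auto simp: f_def intro!: divide_nonneg_pos less_imp_le)
  have "(\<integral>\<^sup>+a. ennreal (f a) \<partial>count_space UNIV) = (\<Sum>a\<in>A. ennreal (f a))"
    using assms by (intro nn_integral_count_space') (auto simp: f_def)
  also have "\<dots> = ennreal (\<Sum>a\<in>A. f a)" using nn by (simp add: sum_ennreal)
  also have "(\<Sum>a\<in>A. f a) = 1"
    using S by (simp add: f_def sum_divide_distrib[symmetric])
  finally have pmf: "pmf (embed_pmf f) a = f a" for a
    using nn by (intro pmf_embed_pmf) auto
  show ?thesis
  proof
    show "set_pmf (embed_pmf f) \<subseteq> A"
      by (auto simp: set_pmf_iff pmf f_def split: if_splits)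
    show "pmf (embed_pmf f) a = W a / sum W A" if "a \<in> A" for a
      using that by (simp add: pmf f_def)
  qed
qed

lemma balanced_random_field_unique:
  assumes fin: "finite \<Lambda>" "finite X"
    and g: "\<And>t w. t \<in> \<Lambda> \<Longrightarrow> w \<in> configs X \<Lambda> \<Longrightarrow> g t w > (0::real)"
    and P: "random_field \<Lambda> X P" "\<forall>w\<in>configs X \<Lambda>. pmf P w > 0"
      "\<forall>t\<in>\<Lambda>. balanced_at \<Lambda> X g (pmf P) t"
    and P': "random_field \<Lambda> X P'" "\<forall>w\<in>configs X \<Lambda>. pmf P' w > 0"
      "\<forall>t\<in>\<Lambda>. balanced_at \<Lambda> X g (pmf P') t"
  shows "P = P'"
proof -
  let ?C = "configs X \<Lambda>"
  have finC: "finite ?C" using fin by (intro finite_PiE) auto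
  have inv: "pmf P (w(t := b)) / pmf P' (w(t := b)) = pmf P w / pmf P' w"
    if w: "w \<in> ?C" and t: "t \<in> \<Lambda>" and b: "b \<in> X" for w t b
  proof -
    have C: "w(t := b) \<in> ?C" using configs_upd[OF w t b] .
    \<comment> \<open>Inserting \<open>g t w\<close> lets balance move numerator and denominator to
      \<open>w\<close>, with a new common factor.\<close>
    have "pmf P (w(t := b)) / pmf P' (w(t := b)) =
      (pmf P (w(t := b)) * g t w) / (pmf P' (w(t := b)) * g t w)"
      using g[OF t w] by simp
    also have "\<dots> = (pmf P w * g t (w(t := b))) / (pmf P' w * g t (w(t := b)))"
      using P(3) P'(3) t w b by (simp add: balanced_at_def)
    also have "\<dots> = pmf P w / pmf P' w"
      using g[OF t C] by simp
    finally show ?thesis .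
  qed
  have const: "pmf P w / pmf P' w = pmf P w' / pmf P' w'" if "w \<in> ?C" "w' \<in> ?C" for w w'
    using single_site_invariant_imp_constant[OF fin(1), where f = "\<lambda>w. pmf P w / pmf P' w"] inv that
    by blast
  have sums: "(\<Sum>w\<in>?C. pmf P w) = 1" "(\<Sum>w\<in>?C. pmf P' w) = 1"
    using P(1) P'(1) finC by (auto simp: random_field_def intro!: sum_pmf_eq_1)
  show ?thesis
  proof (rule pmf_eqI)
    fix w
    show "pmf P w = pmf P' w"
    proof (cases "w \<in> ?C")
      case True
      \<comment> \<open>The ratio \<open>r\<close> is the same on all of \<open>?C\<close>; both
        fields having total mass 1 forces it to be 1.\<close>
      define r where "r = pmf P w / pmf P' w"
      have "pmf P w' = r * pmf P' w'" if "w' \<in> ?C" for w'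
        using const[OF that True] P'(2) that by (force simp: r_def divide_eq_eq)
      then have scale: "\<forall>w'\<in>?C. pmf P w' = r * pmf P' w'" by blast
      then have "(\<Sum>w\<in>?C. pmf P w) = r * (\<Sum>w\<in>?C. pmf P' w)"
        by (simp add: sum_distrib_left)
      then have "r = 1" using sums by simp
      then show ?thesis using scale True by simp
    next
      case False
      then have "w \<notin> set_pmf P" "w \<notin> set_pmf P'"
        using P(1) P'(1) by (auto simp: random_field_def)
      then show ?thesis by (simp add: set_pmf_iff)
    qed
  qed
qed

theorem theorem1:
  fixes \<Lambda> :: "'i set" and X :: "'x set"
    and q :: "'i \<Rightarrow> ('i \<Rightarrow> 'x) \<Rightarrow> 'x pmf"
  assumes "finite \<Lambda>" and "\<Lambda> \<noteq> {}"
    and "finite X" and "X \<noteq> {}"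
    and "positive_one_point_family \<Lambda> X q"
  shows "(\<exists>!P. random_field \<Lambda> X P \<and> compatible_with \<Lambda> X P q) \<longleftrightarrow>
    (\<forall>t\<in>\<Lambda>. \<forall>s\<in>\<Lambda>. t \<noteq> s \<longrightarrow>
      (\<forall>x\<in>X. \<forall>u\<in>X. \<forall>y\<in>X. \<forall>v\<in>X. \<forall>z\<in>configs X (\<Lambda> - {t, s}).
        pmf (q t (z(s := y))) x * pmf (q s (z(t := x))) v *
        pmf (q t (z(s := v))) u * pmf (q s (z(t := u))) y =
        pmf (q t (z(s := y))) u * pmf (q s (z(t := u))) v *
        pmf (q t (z(s := v))) x * pmf (q s (z(t := x))) y))"
  unfolding cycle_condition_spin_prob_iff[symmetric]
proof -
  let ?C = "configs X \<Lambda>" and ?g = "spin_prob q"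
  note gpos = spin_prob_pos[OF assms(5)]
  note comp_iff = balanced_iff_compatible[OF assms(3,4,5,2)]
  show "(\<exists>!P. random_field \<Lambda> X P \<and> compatible_with \<Lambda> X P q) \<longleftrightarrow> cycle_condition \<Lambda> X ?g"
  proof
    assume "\<exists>!P. random_field \<Lambda> X P \<and> compatible_with \<Lambda> X P q"
    then obtain P where "compatible_with \<Lambda> X P q" by blast
    then show "cycle_condition \<Lambda> X ?g"
      unfolding comp_iff by (intro balanced_imp_cycle_condition[where W = "pmf P"]) auto
  next
    assume cyc: "cycle_condition \<Lambda> X ?g"
    obtain W where W: "\<forall>w\<in>?C. W w > 0" "\<forall>t\<in>\<Lambda>. balanced_at \<Lambda> X ?g W t"
      using balanced_weight_exists[OF gpos cyc assms(1) subset_refl assms(4)] by blast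
    have C: "finite ?C" "?C \<noteq> {}"
      using assms by (auto intro!: finite_PiE simp: PiE_eq_empty_iff)
    obtain P where P: "set_pmf P \<subseteq> ?C" "\<And>w. w \<in> ?C \<Longrightarrow> pmf P w = W w / sum W ?C"
      using pmf_of_weight[OF C, of W] W(1) by blast
    have "sum W ?C > 0" using C W(1) by (intro sum_pos) auto
    then have "\<forall>w\<in>?C. pmf P w > 0"
      using P(2) W(1) by simp
    \<comment> \<open>Balance is homogeneous in the weight, so normalising preserves it.\<close>
    moreover have "\<forall>t\<in>\<Lambda>. balanced_at \<Lambda> X ?g (pmf P) t"
      using W(2) P(2) by (auto simp: balanced_at_def configs_upd)
    ultimately have "random_field \<Lambda> X P \<and> compatible_with \<Lambda> X P q"
      unfolding comp_iff using P(1) by (simp add: random_field_def)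
    moreover have "P' = P" if "random_field \<Lambda> X P' \<and> compatible_with \<Lambda> X P' q" for P'
      using that calculation unfolding comp_iff
      by (intro balanced_random_field_unique[OF assms(1,3) gpos]) auto
    ultimately show "\<exists>!P. random_field \<Lambda> X P \<and> compatible_with \<Lambda> X P q" by blast
  qed
qed

end
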